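(* Let $m$ be a non-negative integer, and let $\{r_n\}_{n\ge 0}$ be a recurringly nilpotent integer sequence of the form $$r_0,\ldots,r_{m-1},0,0,0,\ldots,$$ that is, $r_n=0$ for all $n\ge m$ (so $\{r_n\}_{n\ge0}$ is the zero sequence if $m=0$). When $m\ge 1$, suppose that $0\notin\{r_0,\ldots,r_{m-1}\}$. Suppose also that $\{r_n\}_{n\ge 0}$ has a generating polynomial $u\in\mathbb{Z}[x]$. Then exactly one of the following holds: (1) $m=0$, and $\{r_n\}_{n\ge 0}$ is the zero sequence; (2) $m=1$, and then $r_0$ is arbitrary (every nonzero integer occurs as $r_0$ for some such sequence); (3) $m=2$, and then $r_0\mid 2$ and $r_1=2r_0$.
   Context: For $u\in\mathbb{Z}[x]$ and a positive integer $n$, $u^{(n)}$ denotes the $n$-fold composition $u\circ\cdots\circ u$. A polynomial $u\in\mathbb{Z}[x]$ is a generating polynomial of an integer sequence $\{r_n\}_{n\ge 0}$ if $u^{(n)}(r_0)=r_n$ for all $n\ge 1$. An integer sequence $\{r_n\}_{n\ge 0}$ is recurringly nilpotent if $r_n=0$ for infinitely many $n$. *)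

theory Defs
  imports "HOL-Computational_Algebra.Polynomial"
begin

definition poly_iterate :: "int poly \<Rightarrow> nat \<Rightarrow> int poly" where
  "poly_iterate u n = ((\<lambda>p. pcompose u p) ^^ n) [:0, 1:]"

definition generating_polynomial :: "int poly \<Rightarrow> (nat \<Rightarrow> int) \<Rightarrow> bool" where
  "generating_polynomial u r \<longleftrightarrow> (\<forall>n\<ge>1. poly (poly_iterate u n) (r 0) = r n)"

definition recurringly_nilpotent :: "(nat \<Rightarrow> int) \<Rightarrow> bool" where
  "recurringly_nilpotent r \<longleftrightarrow> infinite {n. r n = 0}"

text \<open>The standing hypotheses on the sequence: it has the form
  \<open>r\<^sub>0, \<dots>, r\<^sub>m\<^sub>-\<^sub>1, 0, 0, \<dots>\<close> with nonzero initial terms (none if \<open>m = 0\<close>)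
  and some integer polynomial generates it.\<close>

definition generated_with_zero_tail :: "nat \<Rightarrow> (nat \<Rightarrow> int) \<Rightarrow> bool" where
  "generated_with_zero_tail m r \<longleftrightarrow>
     recurringly_nilpotent r \<and>
     (\<forall>n\<ge>m. r n = 0) \<and>
     0 \<notin> r ` {..<m} \<and>
     (\<exists>u. generating_polynomial u r)"

definition exactly_one_of_three :: "bool \<Rightarrow> bool \<Rightarrow> bool \<Rightarrow> bool" where
  "exactly_one_of_three P Q R \<longleftrightarrow>
     (P \<or> Q \<or> R) \<and> \<not> (P \<and> Q) \<and> \<not> (P \<and> R) \<and> \<not> (Q \<and> R)"

end

theory Submission
  imports Defs
begin

text \<open>A generating polynomial vanishes at \<open>0\<close> and, when \<open>m \<ge> 2\<close>, also at \<open>b = r\<^sub>m\<^sub>-\<^sub>1 \<noteq> 0\<close>, so it is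
  \<open>x (x - b) w(x)\<close>. Evaluating at \<open>a = r\<^sub>m\<^sub>-\<^sub>2\<close> gives \<open>a \<bar> b\<close>, and with \<open>b = k a\<close> that \<open>1 - k\<close> divides
  \<open>k\<close>; hence \<open>k = 2\<close> and \<open>a \<bar> 2\<close>. If \<open>m \<ge> 3\<close>, evaluating at \<open>c = r\<^sub>m\<^sub>-\<^sub>3\<close> gives \<open>a = j c\<close> with
  \<open>1 - 2j\<close> dividing \<open>j\<close>, so \<open>j = 1\<close> and \<open>a = c\<close>, which is impossible.\<close>

lemma poly_poly_iterate: "poly (poly_iterate u n) x = (poly u ^^ n) x"
  by (induction n) (simp_all add: poly_iterate_def poly_pcompose)

lemma generating_polynomial_Suc:
  assumes "generating_polynomial u r"
  shows "r (Suc n) = poly u (r n)"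
proof -
  have "r k = (poly u ^^ k) (r 0)" for k
    using assms by (cases "k = 0") (simp_all add: generating_polynomial_def poly_poly_iterate)
  then show ?thesis
    by (metis comp_apply funpow.simps(2))
qed

lemma poly_two_roots_factor:
  fixes u :: "'a::idom poly"
  assumes "poly u a = 0" "poly u b = 0" "a \<noteq> b"
  obtains w where "u = [:-a, 1:] * [:-b, 1:] * w"
proof -
  obtain v where v: "u = [:-a, 1:] * v"
    using assms(1) by (auto simp: poly_eq_0_iff_dvd)
  then have "poly v b = 0"
    using assms(2,3) by simp
  then obtain w where "v = [:-b, 1:] * w"
    by (auto simp: poly_eq_0_iff_dvd)
  with v that show ?thesis
    by (simp only: mult.assoc)
qed

text \<open>The divisor \<open>1 - k\<close> also divides its sum with \<open>k\<close>, which is 1,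
  so it is a unit.\<close>

lemma one_minus_dvd_selfD:
  fixes k :: int
  assumes "1 - k dvd k"
  shows "k = 0 \<or> k = 2"
proof -
  have "1 - k dvd (1 - k) + k"
    using assms by (intro dvd_add) auto
  then have "\<bar>1 - k\<bar> = 1"
    by simp
  then show ?thesis by arith
qed

text \<open>The same argument, adding the multiple \<open>2 * j\<close> of \<open>j\<close> to reach
  1.\<close>

lemma one_minus_twice_dvd_selfD:
  fixes j :: int
  assumes "1 - 2 * j dvd j"
  shows "j = 0 \<or> j = 1"
proof -
  have "1 - 2 * j dvd (1 - 2 * j) + 2 * j"
    using assms by (intro dvd_add) auto
  then have "\<bar>1 - 2 * j\<bar> = 1"
    by simp
  then show ?thesis by arith
qed

lemma last_two_nonzero_terms:
  fixes u :: "int poly"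
  assumes "poly u 0 = 0" "poly u a = b" "poly u b = 0" "a \<noteq> 0" "b \<noteq> 0"
  shows "b = 2 * a" "a dvd 2"
proof -
  obtain w where w: "u = [:-0, 1:] * [:-b, 1:] * w"
    using poly_two_roots_factor[of u 0 b] assms by metis
  have eq: "b = a * (a - b) * poly w a"
    using assms(2) by (simp add: w algebra_simps)
  then obtain k where k: "b = a * k"
    by (metis mult.assoc)
  \<comment> \<open>With \<open>b = a * k\<close> the factor \<open>a - b\<close> becomes
    \<open>a * (1 - k)\<close>; one \<open>a\<close> then cancels and the other survives to yield
    \<open>a dvd 2\<close>.\<close>
  have "a * k = a * ((1 - k) * (a * poly w a))"
    using eq unfolding k by (simp add: algebra_simps)
  then have eq2: "k = (1 - k) * (a * poly w a)"
    using assms(4) by simp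
  then have "1 - k dvd k"
    by (rule dvdI)
  \<comment> \<open>The alternative \<open>k = 0\<close> would force \<open>b = 0\<close>.\<close>
  with k assms(5) have "k = 2"
    using one_minus_dvd_selfD by fastforce
  then show "b = 2 * a"
    using k by simp
  have "2 = a * - poly w a"
    using eq2 unfolding \<open>k = 2\<close> by simp
  then show "a dvd 2"
    by (rule dvdI)
qed

lemma no_third_nonzero_term:
  fixes u :: "int poly"
  assumes "poly u 0 = 0" "poly u c = a" "poly u a = b" "poly u b = 0"
    and "c \<noteq> 0" "a \<noteq> 0" "b \<noteq> 0"
  shows False
proof -
  have b: "b = 2 * a"
    using last_two_nonzero_terms(1) assms by blast
  obtain w where w: "u = [:-0, 1:] * [:-b, 1:] * w"
    using poly_two_roots_factor[of u 0 b] assms by metis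
  have eq: "a = c * (c - 2 * a) * poly w c"
    using assms(2) by (simp add: w b algebra_simps)
  then obtain j where j: "a = c * j"
    by (metis mult.assoc)
  have "c * j = c * ((1 - 2 * j) * (c * poly w c))"
    using eq unfolding j by (simp add: algebra_simps)
  then have "j = (1 - 2 * j) * (c * poly w c)"
    using assms(5) by simp
  then have "1 - 2 * j dvd j"
    by (rule dvdI)
  with j assms(6) have "j = 1"
    using one_minus_twice_dvd_selfD by fastforce
  \<comment> \<open>Now \<open>c = a\<close>, so \<open>a\<close> and \<open>b\<close> are the same
    value of \<open>u\<close>; with \<open>b = 2 * a\<close> this forces
    \<open>a = 0\<close>.\<close>
  with j b assms show False
    by simp
qed

lemma generated_with_zero_tail_cases:
  assumes "generated_with_zero_tail m r"
  shows "m = 0 \<or> m = 1 \<or> m = 2 \<and> r 0 dvd 2 \<and> r 1 = 2 * r 0"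
proof -
  obtain u where u: "generating_polynomial u r"
    using assms by (auto simp: generated_with_zero_tail_def)
  note step = generating_polynomial_Suc[OF u]
  have tail: "r n = 0" if "n \<ge> m" for n
    using assms that by (auto simp: generated_with_zero_tail_def)
  have nz: "r n \<noteq> 0" if "n < m" for n
    using assms that by (force simp: generated_with_zero_tail_def)
  \<comment> \<open>Both \<open>r m\<close> and its successor lie in the zero tail.\<close>
  have u0: "poly u 0 = 0"
    using step[of m] tail[of m] tail[of "Suc m"] by simp
  consider "m = 0" | "m = 1" | "m = 2" | n where "m = Suc (Suc (Suc n))"
    by (metis One_nat_def numeral_2_eq_2 not0_implies_Suc)
  then show ?thesis
  proof cases
    case 3
    then show ?thesis
      using last_two_nonzero_terms[OF u0, of "r 0" "r 1"] step[of 0] step[of 1]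
        tail[of 2] nz[of 0] nz[of 1]
      by (simp add: numeral_2_eq_2)
  next
    \<comment> \<open>Since \<open>m = n + 3\<close>, the last three nonzero terms serve as
      \<open>c\<close>, \<open>a\<close>, \<open>b\<close>.\<close>
    case (4 n)
    then show ?thesis
      using no_third_nonzero_term[OF u0, of "r n" "r (Suc n)" "r (Suc (Suc n))"]
        step[of n] step[of "Suc n"] step[of "Suc (Suc n)"] tail[of m]
        nz[of n] nz[of "Suc n"] nz[of "Suc (Suc n)"]
      by simp
  qed auto
qed

text \<open>The zero polynomial sends every starting value to 0 in one step.\<close>

lemma generated_with_zero_tail_1_exists:
  assumes "a \<noteq> 0"
  shows "\<exists>r. generated_with_zero_tail 1 r \<and> r 0 = a"
proof (intro exI conjI)
  let ?r = "\<lambda>n::nat. if n = 0 then a else 0"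
  have "{n. ?r n = 0} = {1..}"
    using assms by auto
  then have "recurringly_nilpotent ?r"
    by (simp add: recurringly_nilpotent_def infinite_Ici)
  moreover have "generating_polynomial 0 ?r"
    unfolding generating_polynomial_def poly_poly_iterate
    by (auto elim: less_natE simp: Suc_le_eq)
  ultimately show "generated_with_zero_tail 1 ?r"
    using assms by (auto simp: generated_with_zero_tail_def)
qed simp

theorem theorem4p9:
  "(\<forall>(m :: nat) (r :: nat \<Rightarrow> int). generated_with_zero_tail m r \<longrightarrow>
      exactly_one_of_three
        (m = 0 \<and> (\<forall>n. r n = 0))
        (m = 1)
        (m = 2 \<and> r 0 dvd 2 \<and> r 1 = 2 * r 0)) \<and>
   (\<forall>a :: int. a \<noteq> 0 \<longrightarrow> (\<exists>r. generated_with_zero_tail 1 r \<and> r 0 = a))"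
proof (intro conjI allI impI)
  fix m :: nat and r :: "nat \<Rightarrow> int"
  assume gen: "generated_with_zero_tail m r"
  then have "\<forall>n. r n = 0" if "m = 0"
    using that by (simp add: generated_with_zero_tail_def)
  with generated_with_zero_tail_cases[OF gen]
  show "exactly_one_of_three (m = 0 \<and> (\<forall>n. r n = 0)) (m = 1)
      (m = 2 \<and> r 0 dvd 2 \<and> r 1 = 2 * r 0)"
    by (auto simp: exactly_one_of_three_def)
qed (rule generated_with_zero_tail_1_exists)

end
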